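(* Let $v\in\{0,1,2\}^n$ with $v\ne0$ and $v\ne(2,\dots,2)$, and let $D=\mathbb{F}_3^n\setminus\mathrm{box}(v)$, so $|D|=3^n-2^{t_1}3^{t_2}>0$. For every nonzero $u\in\mathbb{F}_3^n$, \[ \mathrm{wt}(c_D(u))=\tfrac13\Big(2|D|+3^{t_2}e(u)\,2^{z(u)}(-1)^{o(u)}\phi(s_1(u))\Big), \] and for $e\in\{0,1\}$, $0\le z\le t_1$, $c\in\mathbb{F}_3$, the number of nonzero $u\in\mathbb{F}_3^n$ with $e(u)=e$, $z(u)=z$, $s_1(u)=c$ is \[ \big([e=1]+(3^{t_2}-1)[e=0]\big)\binom{t_1}{z}N_c(t_1-z)\,3^{n-t_1-t_2}, \] less one for $(e,z,c)=(1,t_1,0)$.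
   Context: $[\,\cdot\,]$ applied to a condition is $1$ if it holds and $0$ otherwise; $\mathrm{wt}$ is Hamming weight; $c_D(u)=(u\cdot x)_{x\in D}$ with $u\cdot x=\sum_iu_ix_i\in\mathbb{F}_3$. $\mathbb{F}_3$ is identified with $\{0,1,2\}$. For $v\in\{0,1,2\}^n$: $T_j(v)=\{i:v_i=j\}$, $t_j=|T_j(v)|$, $\mathrm{box}(v)=\prod_i\{0,\dots,v_i\}\subseteq\mathbb{F}_3^n$. For $u\in\mathbb{F}_3^n$: $z(u)=|\{i\in T_1(v):u_i=0\}|$, $o(u)=t_1-z(u)$, $s_1(u)=\sum_{i\in T_1(v)}u_i\in\mathbb{F}_3$, $e(u)=1$ if $u_i=0$ for all $i\in T_2(v)$ and $e(u)=0$ otherwise. For $c\in\mathbb{F}_3$, $\phi(c)=2[c=0]-[c\ne0]$. For an integer $o\ge0$ and $c\in\mathbb{F}_3$, $N_c(o)$ is the number of vectors in $\{1,2\}^o$ whose coordinate sum is $c$ in $\mathbb{F}_3$, i.e. $N_0(o)=(2^o+2(-1)^o)/3$ and $N_c(o)=(2^o-(-1)^o)/3$ for $c\ne0$. *)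

theory Defs
  imports "HOL-Analysis.Finite_Cartesian_Product" "HOL-Library.Numeral_Type"
begin

text \<open>
  The numeral type \<^typ>\<open>3\<close> is the ring of integers modulo 3. The identification of
  its elements with the numbers 0, 1, 2 is \<^const>\<open>of_nat\<close> restricted to those numbers.
  The vector \<open>v\<close> is kept as a vector of natural numbers, because its entries serve as
  upper ends of intervals of integers; \<open>n\<close> is the cardinality of the index type.
\<close>

type_synonym F3 = 3

definition dot :: "F3 ^ 'n \<Rightarrow> F3 ^ 'n \<Rightarrow> F3" where
  "dot u x = (\<Sum>i\<in>UNIV. u $ i * x $ i)"

text \<open>A word with coordinate positions \<open>I\<close> is a function of which only the values on \<open>I\<close> matter.\<close>

definition hamming_weight :: "'i set \<Rightarrow> ('i \<Rightarrow> F3) \<Rightarrow> nat" where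
  "hamming_weight I w = card {i \<in> I. w i \<noteq> 0}"

definition codeword :: "(F3 ^ 'n) set \<Rightarrow> F3 ^ 'n \<Rightarrow> (F3 ^ 'n \<Rightarrow> F3)" where
  "codeword D u = restrict (\<lambda>x. dot u x) D"

definition level :: "nat ^ 'n \<Rightarrow> nat \<Rightarrow> 'n set" where
  "level v j = {i. v $ i = j}"

definition lcount :: "nat ^ 'n \<Rightarrow> nat \<Rightarrow> nat" where
  "lcount v j = card (level v j)"

definition down_box :: "nat ^ 'n \<Rightarrow> (F3 ^ 'n) set" where
  "down_box v = {x. \<forall>i. x $ i \<in> of_nat ` {0..v $ i}}"

definition zeros :: "nat ^ 'n \<Rightarrow> F3 ^ 'n \<Rightarrow> nat" where
  "zeros v u = card {i \<in> level v 1. u $ i = 0}"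

definition nonzeros :: "nat ^ 'n \<Rightarrow> F3 ^ 'n \<Rightarrow> nat" where
  "nonzeros v u = lcount v 1 - zeros v u"

definition sum1 :: "nat ^ 'n \<Rightarrow> F3 ^ 'n \<Rightarrow> F3" where
  "sum1 v u = (\<Sum>i\<in>level v 1. u $ i)"

definition e_ind :: "nat ^ 'n \<Rightarrow> F3 ^ 'n \<Rightarrow> nat" where
  "e_ind v u = (if \<forall>i\<in>level v 2. u $ i = 0 then 1 else 0)"

definition phi3 :: "F3 \<Rightarrow> int" where
  "phi3 c = 2 * of_bool (c = 0) - of_bool (c \<noteq> 0)"

definition Nsum :: "F3 \<Rightarrow> nat \<Rightarrow> nat" where
  "Nsum c m = card {w :: F3 list. length w = m \<and> set w \<subseteq> {1, 2} \<and> sum_list w = c}"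

lemma F3_cases: "(c :: F3) = 0 \<or> c = 1 \<or> c = 2"
proof (cases c)
  case (of_int z)
  then have "z = 0 \<or> z = 1 \<or> z = 2" by auto
  with of_int show ?thesis by auto
qed

lemma Nsum_0: "Nsum c 0 = of_bool (c = 0)"
proof -
  have "{w :: F3 list. length w = 0 \<and> set w \<subseteq> {1, 2} \<and> sum_list w = c}
      = (if c = 0 then {[]} else {})" by auto
  then show ?thesis by (simp add: Nsum_def)
qed

lemma Nsum_Suc: "Nsum c (Suc m) = Nsum (c - 1) m + Nsum (c - 2) m"
proof -
  define A where "A d = {w :: F3 list. length w = m \<and> set w \<subseteq> {1, 2} \<and> sum_list w = d}" for d
  have fin: "finite (A d)" for d
    by (rule finite_subset [OF _ finite_lists_length_eq [of "{1, 2}" m]]) (auto simp: A_def)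
  have "{w :: F3 list. length w = Suc m \<and> set w \<subseteq> {1, 2} \<and> sum_list w = c}
      = (#) 1 ` A (c - 1) \<union> (#) 2 ` A (c - 2)"
    by (auto simp: A_def length_Suc_conv image_iff)
  moreover have "card ((#) 1 ` A (c - 1) \<union> (#) 2 ` A (c - 2)) = card (A (c - 1)) + card (A (c - 2))"
    by (subst card_Un_disjoint) (auto simp: fin card_image)
  ultimately show ?thesis by (simp add: Nsum_def A_def)
qed

lemma Nsum_closed_form:
  "3 * int (Nsum c m) = (if c = 0 then 2 ^ m + 2 * (-1) ^ m else 2 ^ m - (-1) ^ m)"
proof (induction m arbitrary: c)
  case 0
  then show ?case by (simp add: Nsum_0)
next
  case (Suc m)
  have "3 * int (Nsum c (Suc m)) = 3 * int (Nsum (c - 1) m) + 3 * int (Nsum (c - 2) m)"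
    by (simp add: Nsum_Suc)
  with F3_cases [of c] show ?case by (auto simp: Suc.IH)
qed

end

theory Submission
  imports Defs
begin

text \<open>
  Since \<open>3 [a \<noteq> 0] = 2 - \<phi>(a)\<close> for \<open>a\<close> in the field of three elements, three times the
  weight of a codeword is \<open>2 |D|\<close> minus the sum of \<open>\<phi>(u \<cdot> x)\<close> over \<open>x \<in> D\<close>, and the latter is
  the sum over the whole space minus the sum over the box. As \<open>\<phi>\<close> is twice the real
  part of a nontrivial additive character \<open>\<chi>\<close>, it suffices to sum \<open>\<chi>(u \<cdot> x)\<close> over a box.
  That sum is a product of one factor per coordinate. A coordinate of level 0 contributes 1;
  one of level 2 contributes 3 or 0, according to whether \<open>u\<close> vanishes there; one of level 1
  contributes \<open>1 + \<chi>(u\<^sub>i)\<close>, which is 2 for \<open>u\<^sub>i = 0\<close> and \<open>- \<chi>(- u\<^sub>i)\<close> otherwise, because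
  the values of \<open>\<chi>\<close> add up to 0. This is the lemma \<open>sum_add_char_down_box\<close>. It is used three
  times: for the given box, for the whole space (the box below the constant vector 2, where the
  sum vanishes for \<open>u \<noteq> 0\<close>), and with \<open>u = 0\<close>, where it gives the cardinality of the box.

  For the enumeration, a vector is the same thing as its three restrictions to the level sets.
  The quantity \<open>e\<close> depends only on the restriction to level 2, whereas \<open>z\<close> and \<open>s\<^sub>1\<close> depend
  only on the restriction to level 1, and the restriction to level 0 is free; so the count is a
  product (\<open>card_vec_restrict\<close>). The factor of level 1, the binomial coefficient times
  \<open>N\<^sub>c(t\<^sub>1 - z)\<close>, follows by induction on the index set from Pascal's rule and the
  recurrence for \<open>N\<close>. Finally, the zero vector lies in the class \<open>(1, t\<^sub>1, 0)\<close> and is removed.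
\<close>

section \<open>The additive character of the field with three elements\<close>

lemma UNIV_F3: "(UNIV :: F3 set) = {0, 1, 2}"
  using F3_cases by auto

text \<open>The character that takes 1 to the primitive cube root of unity in the upper half plane.\<close>

definition add_char :: "F3 \<Rightarrow> complex" where
  "add_char c = (if c = 0 then 1 else if c = 1 then Complex (- 1 / 2) (sqrt 3 / 2)
     else Complex (- 1 / 2) (- sqrt 3 / 2))"

lemma add_char_0 [simp]: "add_char 0 = 1"
  by (simp add: add_char_def)

lemma add_char_add: "add_char (a + b) = add_char a * add_char b"
  using F3_cases [of a] F3_cases [of b]
  by (auto simp: add_char_def complex_eq_iff)

lemma add_char_sum: "add_char (\<Sum>i\<in>A. f i) = (\<Prod>i\<in>A. add_char (f i))"
  by (induction A rule: infinite_finite_induct) (simp_all add: add_char_add)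

lemma phi3_eq_Re_add_char: "real_of_int (phi3 c) = 2 * Re (add_char c)"
  using F3_cases [of c] by (auto simp: phi3_def add_char_def)

lemma phi3_minus: "phi3 (- c) = phi3 c"
  by (simp add: phi3_def)

lemma of_nat_image_01_F3: "of_nat ` {0..1} = {0, 1 :: F3}"
proof -
  have "{0..1} = {0, 1 :: nat}" by auto
  then show ?thesis by simp
qed

lemma of_nat_image_012_F3: "of_nat ` {0..2} = (UNIV :: F3 set)"
proof -
  have "{0..2} = {0, 1, 2 :: nat}" by auto
  then show ?thesis by (simp add: UNIV_F3)
qed

text \<open>
  For \<open>c \<noteq> 0\<close> the sum is \<open>1 + \<chi>(c)\<close>, which is the negative of the third value
  \<open>\<chi>(- c)\<close> of the character. The factor \<open>\<chi>(- c)\<close> is 1 for \<open>c = 0\<close>; writing it in both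
  cases lets the factors combine to \<open>\<chi>(- s\<^sub>1)\<close> in a product over level 1.
\<close>

lemma sum_add_char_interval_1:
  "(\<Sum>a\<in>of_nat ` {0..1}. add_char (c * a)) = (if c = 0 then 2 else - 1) * add_char (- c)"
  unfolding of_nat_image_01_F3
  using F3_cases [of c] by (auto simp: add_char_def complex_eq_iff)

lemma sum_add_char_interval_2:
  "(\<Sum>a\<in>of_nat ` {0..2}. add_char (c * a)) = (if c = 0 then 3 else 0)"
  unfolding of_nat_image_012_F3 UNIV_F3
  using F3_cases [of c] by (auto simp: add_char_def complex_eq_iff)

section \<open>Character sums over boxes\<close>

lemma sum_prod_vec_box:
  fixes g :: "'n::finite \<Rightarrow> 'a \<Rightarrow> 'b::comm_semiring_1"
  assumes "\<And>i. finite (S i)"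
  shows "(\<Sum>x | \<forall>i. x $ i \<in> S i. \<Prod>i\<in>UNIV. g i (x $ i)) = (\<Prod>i\<in>UNIV. \<Sum>a\<in>S i. g i a)"
proof -
  have "(\<Sum>x | \<forall>i. x $ i \<in> S i. \<Prod>i\<in>UNIV. g i (x $ i))
      = (\<Sum>f\<in>Pi\<^sub>E UNIV S. \<Prod>i\<in>UNIV. g i (f i))"
    by (rule sum.reindex_bij_witness [where i = "\<lambda>f. \<chi> i. f i" and j = "\<lambda>x i. x $ i"])
      (auto simp: PiE_iff)
  also have "\<dots> = (\<Prod>i\<in>UNIV. \<Sum>a\<in>S i. g i a)"
    using assms by (simp add: prod_sum_PiE)
  finally show ?thesis .
qed

lemma prod_levels:
  fixes g :: "'n::finite \<Rightarrow> 'b::comm_monoid_mult"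
  assumes "\<forall>i. v $ i \<in> {0, 1, 2}"
  shows "(\<Prod>i\<in>UNIV. g i)
    = (\<Prod>i\<in>level v 0. g i) * (\<Prod>i\<in>level v 1. g i) * (\<Prod>i\<in>level v 2. g i)"
proof -
  have "UNIV = level v 0 \<union> level v 1 \<union> level v 2"
    using assms by (auto simp: level_def)
  moreover have "prod g (level v 0 \<union> level v 1 \<union> level v 2)
      = (\<Prod>i\<in>level v 0. g i) * (\<Prod>i\<in>level v 1. g i) * (\<Prod>i\<in>level v 2. g i)"
    by (subst prod.union_disjoint, simp, simp, force simp: level_def)+ simp
  ultimately show ?thesis by simp
qed

lemma sum_add_char_down_box:
  fixes v :: "nat ^ 'n" and u :: "F3 ^ 'n"
  assumes v: "\<forall>i. v $ i \<in> {0, 1, 2}"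
  shows "(\<Sum>x\<in>down_box v. add_char (dot u x))
    = 3 ^ lcount v 2 * of_nat (e_ind v u) * 2 ^ zeros v u * (- 1) ^ nonzeros v u
        * add_char (- sum1 v u)"
proof -
  define G where "G i = (\<Sum>a\<in>of_nat ` {0..v $ i}. add_char (u $ i * a))" for i
  have "(\<Sum>x\<in>down_box v. add_char (dot u x)) = (\<Prod>i\<in>UNIV. G i)"
    unfolding G_def down_box_def dot_def add_char_sum by (rule sum_prod_vec_box) simp
  also have "\<dots> = (\<Prod>i\<in>level v 0. G i) * (\<Prod>i\<in>level v 1. G i) * (\<Prod>i\<in>level v 2. G i)"
    using v by (rule prod_levels)
  also have "(\<Prod>i\<in>level v 0. G i) = 1"
    by (rule prod.neutral) (simp add: level_def G_def)
  also have "(\<Prod>i\<in>level v 2. G i) = (\<Prod>i\<in>level v 2. if u $ i = 0 then 3 else 0)"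
  proof (rule prod.cong)
    fix i assume "i \<in> level v 2"
    then show "G i = (if u $ i = 0 then 3 else 0)"
      using sum_add_char_interval_2 [of "u $ i"] by (simp only: level_def G_def mem_Collect_eq)
  qed simp
  also have "\<dots> = 3 ^ lcount v 2 * of_nat (e_ind v u)"
  proof (cases "\<forall>i\<in>level v 2. u $ i = 0")
    case True
    then show ?thesis by (simp add: e_ind_def lcount_def)
  next
    case False
    then obtain i where "i \<in> level v 2" "u $ i \<noteq> 0" by auto
    then have *: "(\<Prod>i\<in>level v 2. if u $ i = 0 then 3 else 0) = (0 :: complex)"
      by (intro prod_zero) auto
    have "e_ind v u = 0"
      unfolding e_ind_def using False by (rule if_not_P)
    then show ?thesis unfolding * by simp
  qed
  also have "(\<Prod>i\<in>level v 1. G i)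
      = (\<Prod>i\<in>level v 1. (if u $ i = 0 then 2 else - 1) * add_char (- u $ i))"
  proof (rule prod.cong)
    fix i assume "i \<in> level v 1"
    then show "G i = (if u $ i = 0 then 2 else - 1) * add_char (- u $ i)"
      using sum_add_char_interval_1 [of "u $ i"]
      by (simp only: level_def G_def mem_Collect_eq vector_uminus_component)
  qed simp
  also have "\<dots> = (\<Prod>i\<in>level v 1. if u $ i = 0 then 2 else - 1) * add_char (- sum1 v u)"
    by (simp add: prod.distrib sum1_def add_char_sum flip: sum_negf)
  also have "(\<Prod>i\<in>level v 1. if u $ i = 0 then 2 else - 1)
      = (2 ^ zeros v u * (- 1) ^ nonzeros v u :: complex)"
  proof -
    have *: "level v 1 \<inter> {i. u $ i = 0} = {i \<in> level v 1. u $ i = 0}" by auto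
    have "card (level v 1 \<inter> - {i. u $ i = 0}) = nonzeros v u"
      using card_Int_Diff [of "level v 1" "{i. u $ i = 0}"]
      unfolding nonzeros_def lcount_def zeros_def * Diff_eq by simp
    then show ?thesis
      unfolding zeros_def * [symmetric] by (simp add: prod.If_cases)
  qed
  finally show ?thesis by (simp add: mult_ac)
qed

lemma sum_phi3_down_box:
  fixes v :: "nat ^ 'n" and u :: "F3 ^ 'n"
  assumes "\<forall>i. v $ i \<in> {0, 1, 2}"
  shows "(\<Sum>x\<in>down_box v. real_of_int (phi3 (dot u x)))
    = 3 ^ lcount v 2 * real (e_ind v u) * 2 ^ zeros v u * (- 1) ^ nonzeros v u
        * real_of_int (phi3 (sum1 v u))"
proof -
  define r :: real
    where "r = 3 ^ lcount v 2 * real (e_ind v u) * 2 ^ zeros v u * (- 1) ^ nonzeros v u"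
  have "(\<Sum>x\<in>down_box v. real_of_int (phi3 (dot u x)))
      = 2 * Re (\<Sum>x\<in>down_box v. add_char (dot u x))"
    by (simp add: phi3_eq_Re_add_char sum_distrib_left)
  also have "(\<Sum>x\<in>down_box v. add_char (dot u x)) = of_real r * add_char (- sum1 v u)"
    by (simp add: sum_add_char_down_box [OF assms] r_def)
  also have "2 * Re \<dots> = r * real_of_int (phi3 (- sum1 v u))"
    by (simp add: phi3_eq_Re_add_char)
  finally show ?thesis by (simp add: phi3_minus r_def)
qed

lemma down_box_2: "down_box (\<chi> i. 2) = UNIV"
  by (simp add: down_box_def of_nat_image_012_F3)

text \<open>
  The whole space is the box below the constant vector 2, for which \<open>e(u) = 0\<close>
  because all coordinates have level 2.
\<close>

lemma sum_phi3_UNIV: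
  fixes u :: "F3 ^ 'n"
  assumes "u \<noteq> 0"
  shows "(\<Sum>x\<in>UNIV. phi3 (dot u x)) = 0"
proof -
  have "e_ind (\<chi> i. 2) u = 0"
    using assms by (auto simp: e_ind_def level_def vec_eq_iff)
  then have "(\<Sum>x\<in>UNIV. real_of_int (phi3 (dot u x))) = 0"
    using sum_phi3_down_box [of "\<chi> i. 2" u] by (simp add: down_box_2)
  then show ?thesis by (simp flip: of_int_sum)
qed

lemma zeros_0: "zeros v 0 = lcount v 1"
  by (simp add: zeros_def lcount_def)

lemma card_down_box:
  fixes v :: "nat ^ 'n"
  assumes "\<forall>i. v $ i \<in> {0, 1, 2}"
  shows "card (down_box v) = 2 ^ lcount v 1 * 3 ^ lcount v 2"
proof -
  have "(of_nat (card (down_box v)) :: complex)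
      = (\<Sum>x\<in>down_box v. add_char (dot 0 x))"
    by (simp add: dot_def)
  also have "\<dots> = 3 ^ lcount v 2 * 2 ^ lcount v 1"
    by (simp add: sum_add_char_down_box [OF assms] zeros_0 nonzeros_def e_ind_def sum1_def)
  also have "\<dots> = of_nat (2 ^ lcount v 1 * 3 ^ lcount v 2)" by simp
  finally show ?thesis by (simp only: of_nat_eq_iff)
qed

section \<open>Weights\<close>

lemma three_hamming_weight_codeword:
  "3 * int (hamming_weight D (codeword D u)) = (\<Sum>x\<in>D. 2 - phi3 (dot u x))"
proof -
  have "{x \<in> D. codeword D u x \<noteq> 0} = {x \<in> D. dot u x \<noteq> 0}"
    by (auto simp: codeword_def)
  then have "int (hamming_weight D (codeword D u)) = (\<Sum>x\<in>D. of_bool (dot u x \<noteq> 0))"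
    by (simp add: hamming_weight_def Int_def)
  then have "3 * int (hamming_weight D (codeword D u)) = (\<Sum>x\<in>D. 3 * of_bool (dot u x \<noteq> 0))"
    by (simp only: sum_distrib_left)
  also have "\<dots> = (\<Sum>x\<in>D. 2 - phi3 (dot u x))"
    by (rule sum.cong) (auto simp: phi3_def)
  finally show ?thesis .
qed

lemma hamming_weight_codeword_compl_box:
  fixes v :: "nat ^ 'n" and u :: "F3 ^ 'n"
  assumes v: "\<forall>i. v $ i \<in> {0, 1, 2}" and "u \<noteq> 0"
  defines "D \<equiv> UNIV - down_box v"
  shows "real (hamming_weight D (codeword D u)) =
    1 / 3 * (2 * real (card D) +
      3 ^ lcount v 2 * real (e_ind v u) * 2 ^ zeros v u * (-1) ^ nonzeros v u
        * real_of_int (phi3 (sum1 v u)))"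
proof -
  have "(\<Sum>x\<in>D. phi3 (dot u x)) = - (\<Sum>x\<in>down_box v. phi3 (dot u x))"
    using sum_phi3_UNIV [OF \<open>u \<noteq> 0\<close>] by (simp add: D_def sum_diff)
  then have "3 * int (hamming_weight D (codeword D u))
      = 2 * int (card D) + (\<Sum>x\<in>down_box v. phi3 (dot u x))"
    by (simp add: three_hamming_weight_codeword sum_subtractf)
  then have "real_of_int (3 * int (hamming_weight D (codeword D u)))
      = real_of_int (2 * int (card D) + (\<Sum>x\<in>down_box v. phi3 (dot u x)))"
    by (rule arg_cong)
  then show ?thesis
    by (simp add: sum_phi3_down_box [OF v])
qed

section \<open>Enumeration of vectors by their invariants\<close>

text \<open>
  Counting vectors by independent conditions on their coordinates in two disjoint index sets;
  the remaining coordinates are free. Restrictions are represented as extensional functions.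
\<close>

lemma card_vec_restrict:
  fixes A B :: "'n::finite set" and P Q :: "('n \<Rightarrow> 'a::finite) \<Rightarrow> bool"
  assumes "A \<inter> B = {}"
  shows "card {u :: 'a ^ 'n. P (restrict (($) u) A) \<and> Q (restrict (($) u) B)}
    = card {f \<in> A \<rightarrow>\<^sub>E UNIV. P f} * card {f \<in> B \<rightarrow>\<^sub>E UNIV. Q f}
        * CARD('a) ^ (CARD('n) - card A - card B)"
proof -
  let ?C = "- (A \<union> B)"
  have "bij_betw (\<lambda>u. (restrict (($) u) A, restrict (($) u) B, restrict (($) u) ?C))
     {u :: 'a ^ 'n. P (restrict (($) u) A) \<and> Q (restrict (($) u) B)}
     ({f \<in> A \<rightarrow>\<^sub>E UNIV. P f} \<times> {f \<in> B \<rightarrow>\<^sub>E UNIV. Q f} \<times> (?C \<rightarrow>\<^sub>E (UNIV :: 'a set)))"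
  proof (rule bij_betwI [where
        g = "\<lambda>(f, g, h). \<chi> i. if i \<in> A then f i else if i \<in> B then g i else h i"])
    have eq: "restrict (\<lambda>i. if i \<in> A then f i else if i \<in> B then g i else h i) A = f"
        "restrict (\<lambda>i. if i \<in> A then f i else if i \<in> B then g i else h i) B = g"
        "restrict (\<lambda>i. if i \<in> A then f i else if i \<in> B then g i else h i) ?C = h"
      if "f \<in> A \<rightarrow>\<^sub>E UNIV" "g \<in> B \<rightarrow>\<^sub>E UNIV" "h \<in> ?C \<rightarrow>\<^sub>E UNIV" for f g h :: "'n \<Rightarrow> 'a"
      using that assms by (auto simp: fun_eq_iff restrict_def PiE_iff extensional_def)
    show "(\<lambda>(f, g, h). \<chi> i. if i \<in> A then f i else if i \<in> B then g i else h i)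
        \<in> {f \<in> A \<rightarrow>\<^sub>E UNIV. P f} \<times> {f \<in> B \<rightarrow>\<^sub>E UNIV. Q f} \<times> (?C \<rightarrow>\<^sub>E (UNIV :: 'a set))
          \<rightarrow> {u. P (restrict (($) u) A) \<and> Q (restrict (($) u) B)}"
      by (clarsimp simp: eq vec_lambda_inverse)
    fix y assume "y \<in> {f \<in> A \<rightarrow>\<^sub>E UNIV. P f} \<times> {f \<in> B \<rightarrow>\<^sub>E UNIV. Q f} \<times> (?C \<rightarrow>\<^sub>E (UNIV :: 'a set))"
    then show "(\<lambda>u. (restrict (($) u) A, restrict (($) u) B, restrict (($) u) ?C))
        ((\<lambda>(f, g, h). \<chi> i. if i \<in> A then f i else if i \<in> B then g i else h i) y) = y"
      by (clarsimp simp: eq [simplified] vec_lambda_inverse)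
  qed (auto simp: vec_eq_iff)
  then have "card {u :: 'a ^ 'n. P (restrict (($) u) A) \<and> Q (restrict (($) u) B)}
     = card {f \<in> A \<rightarrow>\<^sub>E UNIV. P f} * card {f \<in> B \<rightarrow>\<^sub>E UNIV. Q f} * CARD('a) ^ card ?C"
    by (simp add: bij_betw_same_card card_cartesian_product card_PiE)
  also have "card ?C = CARD('n) - card A - card B"
    using assms by (simp add: Compl_eq_Diff_UNIV card_Diff_subset card_Un_disjoint)
  finally show ?thesis .
qed

text \<open>
  Counting functions on an enlarged domain by their value at the new argument.
\<close>

lemma card_PiE_insert_sum:
  assumes "finite A" "a \<notin> A" "finite T"
  shows "card {f \<in> insert a A \<rightarrow>\<^sub>E T. P f} = (\<Sum>y\<in>T. card {f \<in> A \<rightarrow>\<^sub>E T. P (f(a := y))})"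
proof -
  have inj: "inj_on (\<lambda>(y, f). f(a := y)) (Sigma T (\<lambda>y. {f \<in> A \<rightarrow>\<^sub>E T. P (f(a := y))}))"
    by (rule inj_on_subset [OF inj_combinator [OF \<open>a \<notin> A\<close>, of "\<lambda>_. T"]]) auto
  have "{f \<in> insert a A \<rightarrow>\<^sub>E T. P f}
      = (\<lambda>(y, f). f(a := y)) ` Sigma T (\<lambda>y. {f \<in> A \<rightarrow>\<^sub>E T. P (f(a := y))})"
    by (auto simp: PiE_insert_eq image_iff)
  then show ?thesis
    using assms by (simp add: card_image [OF inj] card_SigmaI finite_PiE)
qed

text \<open>
  The coordinates outside the zero set are nonzero, whence the number \<open>N\<close>.
  Conditioning on the value at a new index turns the left-hand side into three counts over the
  smaller set, and Pascal's rule together with \<open>Nsum_Suc\<close> decomposes the right-hand side alike.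
\<close>

lemma card_fun_zeros_sum:
  assumes "finite A"
  shows "card {f \<in> A \<rightarrow>\<^sub>E (UNIV :: F3 set). card {i \<in> A. f i = 0} = z \<and> (\<Sum>i\<in>A. f i) = c}
    = (card A choose z) * Nsum c (card A - z)"
  using assms
proof (induction A arbitrary: z c rule: finite_induct)
  case empty
  then show ?case by (cases z) (auto simp: Nsum_0)
next
  case (insert a A)
  define N where "N k d =
    card {f \<in> A \<rightarrow>\<^sub>E (UNIV :: F3 set). card {i \<in> A. f i = 0} = k \<and> (\<Sum>i\<in>A. f i) = d}" for k d
  define M where "M y =
    card {f \<in> A \<rightarrow>\<^sub>E (UNIV :: F3 set). card {i \<in> insert a A. (f(a := y)) i = 0} = z
      \<and> (\<Sum>i\<in>insert a A. (f(a := y)) i) = c}" for y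
  have zeros: "{i \<in> insert a A. (f(a := y)) i = 0}
      = (if y = 0 then insert a {i \<in> A. f i = 0} else {i \<in> A. f i = 0})" for f and y :: F3
    using \<open>a \<notin> A\<close> by auto
  have "(\<Sum>i\<in>A. (f(a := y)) i) = (\<Sum>i\<in>A. f i)" for f and y :: F3
    using \<open>a \<notin> A\<close> by (intro sum.cong) auto
  then have sums: "(\<Sum>i\<in>insert a A. (f(a := y)) i) = c \<longleftrightarrow> (\<Sum>i\<in>A. f i) = c - y"
    for f and y :: F3
    using insert.hyps by (simp del: fun_upd_apply) (auto simp: algebra_simps)
  have N: "N k d = (card A choose k) * Nsum d (card A - k)" for k d
    unfolding N_def by (rule insert.IH)
  have card_insert: "card (insert a A) = Suc (card A)"
    using insert.hyps by simp
  have M_nonzero: "M y = N z (c - y)" if "y \<noteq> 0" for y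
    unfolding M_def N_def zeros sums using that by simp
  have M_0: "M 0 = (case z of 0 \<Rightarrow> 0 | Suc k \<Rightarrow> N k c)"
    unfolding M_def N_def zeros sums using insert.hyps by (simp split: nat.split)
  have "card {f \<in> insert a A \<rightarrow>\<^sub>E (UNIV :: F3 set).
      card {i \<in> insert a A. f i = 0} = z \<and> (\<Sum>i\<in>insert a A. f i) = c} = (\<Sum>y\<in>UNIV. M y)"
    unfolding M_def using insert.hyps by (rule card_PiE_insert_sum) simp
  also have "(\<Sum>y\<in>UNIV. M y) = M 0 + N z (c - 1) + N z (c - 2)"
    unfolding UNIV_F3 using M_nonzero [of 1] M_nonzero [of 2] by (simp add: add.assoc)
  also have "\<dots> = (card (insert a A) choose z) * Nsum c (card (insert a A) - z)"
  proof (cases z)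
    case 0
    then show ?thesis
      unfolding card_insert by (simp add: M_0 N Nsum_Suc)
  next
    case (Suc k)
    show ?thesis
    proof (cases "z \<le> card A")
      case True
      then have "card A - k = Suc (card A - z)" using Suc by simp
      then show ?thesis
        unfolding card_insert using Suc by (simp add: M_0 N Nsum_Suc add_mult_distrib add_mult_distrib2)
    next
      case False
      then show ?thesis
        unfolding card_insert using Suc False by (simp add: M_0 N binomial_eq_0)
    qed
  qed
  finally show ?case .
qed

lemma card_fun_all_zero:
  assumes "finite A" and "\<epsilon> \<in> {0, 1 :: nat}"
  shows "int (card {f \<in> A \<rightarrow>\<^sub>E (UNIV :: F3 set). (if \<forall>i\<in>A. f i = 0 then 1 else 0) = \<epsilon>})
    = of_bool (\<epsilon> = 1) + (3 ^ card A - 1) * of_bool (\<epsilon> = 0)"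
proof -
  let ?F = "A \<rightarrow>\<^sub>E (UNIV :: F3 set)"
  have Z: "{f \<in> ?F. \<forall>i\<in>A. f i = 0} = {restrict (\<lambda>_. 0) A}"
    by (auto simp: fun_eq_iff PiE_iff extensional_def)
  have "{f \<in> ?F. \<not> (\<forall>i\<in>A. f i = 0)} = ?F - {restrict (\<lambda>_. 0) A}"
    unfolding Z [symmetric] by auto
  moreover have "card ?F = 3 ^ card A"
    using assms by (simp add: card_PiE)
  moreover have "finite ?F"
    using assms by (simp add: finite_PiE)
  ultimately have "int (card {f \<in> ?F. \<not> (\<forall>i\<in>A. f i = 0)}) = 3 ^ card A - 1"
    by (simp add: card_Diff_subset of_nat_diff)
  moreover have "card {f \<in> ?F. \<forall>i\<in>A. f i = 0} = 1"
    by (simp add: Z)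
  moreover have "{f \<in> ?F. (if \<forall>i\<in>A. f i = 0 then 1 else 0) = \<epsilon>}
      = (if \<epsilon> = 1 then {f \<in> ?F. \<forall>i\<in>A. f i = 0} else {f \<in> ?F. \<not> (\<forall>i\<in>A. f i = 0)})"
    using assms(2) by auto
  ultimately show ?thesis
    using assms(2) by auto
qed

lemma card_vec_invariants:
  fixes v :: "nat ^ 'n"
  assumes "\<epsilon> \<in> {0, 1}"
  shows "int (card {u :: F3 ^ 'n. e_ind v u = \<epsilon> \<and> zeros v u = z \<and> sum1 v u = c})
    = (of_bool (\<epsilon> = 1) + (3 ^ lcount v 2 - 1) * of_bool (\<epsilon> = 0))
        * int (lcount v 1 choose z) * int (Nsum c (lcount v 1 - z))
        * 3 ^ (CARD('n) - lcount v 1 - lcount v 2)"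
proof -
  define P where "P f \<longleftrightarrow> card {i \<in> level v 1. f i = 0} = z \<and> (\<Sum>i\<in>level v 1. f i) = c"
    for f :: "'n \<Rightarrow> F3"
  define Q where "Q f \<longleftrightarrow> (if \<forall>i\<in>level v 2. f i = 0 then 1 else 0) = \<epsilon>"
    for f :: "'n \<Rightarrow> F3"
  have "{i \<in> level v 1. restrict (($) u) (level v 1) i = 0} = {i \<in> level v 1. u $ i = 0}"
    for u :: "F3 ^ 'n"
    by auto
  then have "{u :: F3 ^ 'n. e_ind v u = \<epsilon> \<and> zeros v u = z \<and> sum1 v u = c}
      = {u. P (restrict (($) u) (level v 1)) \<and> Q (restrict (($) u) (level v 2))}"
    unfolding P_def Q_def by (auto simp: e_ind_def zeros_def sum1_def)
  moreover have "level v 1 \<inter> level v 2 = {}"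
    by (auto simp: level_def)
  moreover have "card {f \<in> level v 1 \<rightarrow>\<^sub>E UNIV. P f}
      = (lcount v 1 choose z) * Nsum c (lcount v 1 - z)"
    unfolding P_def lcount_def by (rule card_fun_zeros_sum) simp
  moreover have "int (card {f \<in> level v 2 \<rightarrow>\<^sub>E UNIV. Q f})
      = of_bool (\<epsilon> = 1) + (3 ^ lcount v 2 - 1) * of_bool (\<epsilon> = 0)"
    unfolding Q_def lcount_def using assms by (intro card_fun_all_zero) simp_all
  ultimately show ?thesis
    by (simp add: card_vec_restrict lcount_def mult_ac)
qed

lemma card_nonzero_vec_invariants:
  fixes v :: "nat ^ 'n"
  shows "int (card {u :: F3 ^ 'n. u \<noteq> 0 \<and> e_ind v u = \<epsilon> \<and> zeros v u = z \<and> sum1 v u = c})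
    = int (card {u :: F3 ^ 'n. e_ind v u = \<epsilon> \<and> zeros v u = z \<and> sum1 v u = c})
        - of_bool ((\<epsilon>, z, c) = (1, lcount v 1, 0))"
proof -
  define S where "S = {u :: F3 ^ 'n. e_ind v u = \<epsilon> \<and> zeros v u = z \<and> sum1 v u = c}"
  have "{u :: F3 ^ 'n. u \<noteq> 0 \<and> e_ind v u = \<epsilon> \<and> zeros v u = z \<and> sum1 v u = c} = S - {0}"
    by (auto simp: S_def)
  moreover have "0 \<in> S \<longleftrightarrow> (\<epsilon>, z, c) = (1, lcount v 1, 0)"
    by (auto simp: S_def zeros_0 e_ind_def sum1_def)
  moreover have "int (card (S - {0})) = int (card S) - of_bool (0 \<in> S)"
    using card_Suc_Diff1 [of S 0] by (cases "0 \<in> S") simp_all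
  ultimately show ?thesis
    unfolding S_def [symmetric] by (simp only:)
qed

section \<open>Weight distribution of the code of a box complement\<close>

theorem theorem6p2:
  fixes v :: "nat ^ 'n" and D :: "(F3 ^ 'n) set"
  assumes "\<forall>i. v $ i \<in> {0, 1, 2}"
    and "v \<noteq> 0"
    and "v \<noteq> (\<chi> i. 2)"
    and "D = UNIV - down_box v"
  shows "int (card D) = 3 ^ CARD('n) - 2 ^ lcount v 1 * 3 ^ lcount v 2 \<and> card D > 0 \<and>
    (\<forall>u :: F3 ^ 'n. u \<noteq> 0 \<longrightarrow>
      real (hamming_weight D (codeword D u)) =
        1 / 3 * (2 * real (card D) +
          3 ^ lcount v 2 * real (e_ind v u) * 2 ^ zeros v u * (-1) ^ nonzeros v u * real_of_int (phi3 (sum1 v u)))) \<and>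
    (\<forall>\<epsilon> \<in> {0, 1}. \<forall>z \<in> {0..lcount v 1}. \<forall>c :: F3.
      int (card {u :: F3 ^ 'n. u \<noteq> 0 \<and> e_ind v u = \<epsilon> \<and> zeros v u = z \<and> sum1 v u = c}) =
        (of_bool (\<epsilon> = 1) + (3 ^ lcount v 2 - 1) * of_bool (\<epsilon> = 0))
          * int (lcount v 1 choose z) * int (Nsum c (lcount v 1 - z)) * 3 ^ (CARD('n) - lcount v 1 - lcount v 2)
        - of_bool ((\<epsilon>, z, c) = (1, lcount v 1, 0)))"
proof (intro conjI allI impI ballI)
  have card_D: "card D = 3 ^ CARD('n) - card (down_box v)"
    using assms(4) by (simp add: card_Diff_subset CARD_vec)
  have "card (down_box v) \<le> 3 ^ CARD('n)"
    using card_mono [of "UNIV :: (F3 ^ 'n) set" "down_box v"] by (simp add: CARD_vec)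
  then show "int (card D) = 3 ^ CARD('n) - 2 ^ lcount v 1 * 3 ^ lcount v 2"
    unfolding card_D by (simp add: of_nat_diff card_down_box [OF assms(1)])
  obtain i where "v $ i \<noteq> 2"
    using assms(3) by (auto simp: vec_eq_iff)
  then have "v $ i = 0 \<or> v $ i = 1"
    using assms(1) by auto
  \<comment> \<open>At a coordinate of level below 2 the element 2 is not attained, so the box is proper.\<close>
  then have "{0..v $ i} \<subseteq> {0..1}"
    by auto
  then have "of_nat ` {0..v $ i} \<subseteq> {0, 1 :: F3}"
    unfolding of_nat_image_01_F3 [symmetric] by (rule image_mono)
  then have "2 \<notin> (of_nat :: nat \<Rightarrow> F3) ` {0..v $ i}"
    by auto
  then have "(\<chi> i. 2) \<in> D"
    unfolding assms(4) down_box_def by auto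
  then show "card D > 0"
    by (auto simp: card_gt_0_iff)
next
  fix u :: "F3 ^ 'n"
  assume "u \<noteq> 0"
  with assms(1) show "real (hamming_weight D (codeword D u)) =
      1 / 3 * (2 * real (card D) +
        3 ^ lcount v 2 * real (e_ind v u) * 2 ^ zeros v u * (-1) ^ nonzeros v u
          * real_of_int (phi3 (sum1 v u)))"
    unfolding assms(4) by (rule hamming_weight_codeword_compl_box)
next
  fix \<epsilon> z :: nat and c :: F3
  assume "\<epsilon> \<in> {0, 1}"
  then show "int (card {u :: F3 ^ 'n. u \<noteq> 0 \<and> e_ind v u = \<epsilon> \<and> zeros v u = z \<and> sum1 v u = c}) =
      (of_bool (\<epsilon> = 1) + (3 ^ lcount v 2 - 1) * of_bool (\<epsilon> = 0))
        * int (lcount v 1 choose z) * int (Nsum c (lcount v 1 - z))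
        * 3 ^ (CARD('n) - lcount v 1 - lcount v 2)
      - of_bool ((\<epsilon>, z, c) = (1, lcount v 1, 0))"
    by (simp only: card_nonzero_vec_invariants card_vec_invariants)
qed

end
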